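(* With initial data $(\tau_0,\tau_1,\tau_2)=(1,1,1)$, the recurrence $$\tau_{n+3}\tau_n=\tau_{n+2}^2+\tau_{n+1}^2+J$$ gives, for $n\ge 0$, a sequence of monic polynomials $\tau_n=p_n(N)\in\mathbb{Z}[N]$ in the variable $N=J+3$, with $\deg p_n=f_n-1$ for all $n>0$, where $f_n$ is the $n$th Fibonacci number. For every real $N>2$, the inequalities $p_{n+1}(N)>p_n(N)>1$ hold for all $n\ge 3$. Furthermore, for every real $N>2$ and all $n\ge 4$, $$(N-1)^{f_n-1}<p_n(N)<N^{f_n-1}.$$
   Context: $J$ is an indeterminate and the recurrence is understood in the field $\mathbb{Q}(J)=\mathbb{Q}(N)$. The Fibonacci numbers are normalized by $f_0=0$, $f_1=1$, $f_{n+2}=f_{n+1}+f_n$. *)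

theory Defs
  imports
    "HOL-Computational_Algebra.Polynomial"
    "HOL-Computational_Algebra.Fraction_Field"
    "HOL-Number_Theory.Fib"
begin

definition J :: "rat poly fract" where
  "J = Fraction_Field.Fract [:0, 1:] 1"

definition N :: "rat poly fract" where
  "N = J + 3"

text \<open>The recurrence is kept in product form, so that no convention about division by zero
  enters: that a solution exists and is unique has to be proved.\<close>

definition tau_sequence :: "(nat \<Rightarrow> rat poly fract) \<Rightarrow> bool" where
  "tau_sequence \<tau> \<longleftrightarrow>
     \<tau> 0 = 1 \<and> \<tau> 1 = 1 \<and> \<tau> 2 = 1 \<and>
     (\<forall>n. \<tau> (n + 3) * \<tau> n = (\<tau> (n + 2))\<^sup>2 + (\<tau> (n + 1))\<^sup>2 + J)"

definition eval_int_poly :: "int poly \<Rightarrow> 'a::comm_ring_1 \<Rightarrow> 'a" where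
  "eval_int_poly q x = poly (map_poly of_int q) x"

end

theory Submission
  imports Defs
begin

text \<open>The cubic quantity
  \<open>\<tau>\<^sub>n\<^sup>2 + \<tau>\<^sub>n\<^sub>+\<^sub>1\<^sup>2 + \<tau>\<^sub>n\<^sub>+\<^sub>2\<^sup>2 - N \<tau>\<^sub>n \<tau>\<^sub>n\<^sub>+\<^sub>1 \<tau>\<^sub>n\<^sub>+\<^sub>2\<close>,
  familiar from the Markov equation, is quadratic in each variable, so replacing \<open>\<tau>\<^sub>n\<close> by the
  other root \<open>N \<tau>\<^sub>n\<^sub>+\<^sub>1 \<tau>\<^sub>n\<^sub>+\<^sub>2 - \<tau>\<^sub>n\<close> preserves it. At \<open>(1,1,1)\<close> its value is \<open>3 - N = -J\<close>,
  and the product of the two roots is then \<open>\<tau>\<^sub>n\<^sub>+\<^sub>1\<^sup>2 + \<tau>\<^sub>n\<^sub>+\<^sub>2\<^sup>2 + J\<close>. Hence the division-free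
  recurrence \<open>\<tau>\<^sub>n\<^sub>+\<^sub>3 = N \<tau>\<^sub>n\<^sub>+\<^sub>1 \<tau>\<^sub>n\<^sub>+\<^sub>2 - \<tau>\<^sub>n\<close> solves the given one
  (lemma \<open>markov_seq_quadratic\<close>), which makes integrality, monicity and the Fibonacci degrees
  visible: the product term dominates, and degrees plus one add up.

  The inequalities also come from the division-free recurrence. For \<open>x > 2\<close> the sequence is at least
  1 and nondecreasing, so the subtracted term lies between \<open>0\<close> and \<open>\<tau>\<^sub>n\<^sub>+\<^sub>1 \<tau>\<^sub>n\<^sub>+\<^sub>2\<close>; thus
  \<open>\<tau>\<^sub>n\<^sub>+\<^sub>3\<close> lies between \<open>x - 1\<close> and \<open>x\<close> times \<open>\<tau>\<^sub>n\<^sub>+\<^sub>1 \<tau>\<^sub>n\<^sub>+\<^sub>2\<close>, and the exponents \<open>fib n - 1\<close>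
  follow as the degrees do. The positivity argument works in every ordered
  integral domain. Applied in the field of rational functions, ordered so that \<open>J\<close> is infinitely
  large, it shows that no term of the solution vanishes, whence the solution is unique.\<close>

fun markov_seq :: "'a::comm_ring_1 \<Rightarrow> nat \<Rightarrow> 'a" where
  "markov_seq x 0 = 1"
| "markov_seq x (Suc 0) = 1"
| "markov_seq x (Suc (Suc 0)) = 1"
| "markov_seq x (Suc (Suc (Suc n))) =
     x * markov_seq x (Suc (Suc n)) * markov_seq x (Suc n) - markov_seq x n"

section \<open>The conserved cubic\<close>

lemma markov_seq_cubic:
  "(markov_seq x n)\<^sup>2 + (markov_seq x (Suc n))\<^sup>2 + (markov_seq x (Suc (Suc n)))\<^sup>2
     = x * markov_seq x n * markov_seq x (Suc n) * markov_seq x (Suc (Suc n)) + 3 - x"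
proof (induction n)
  case (Suc n)
  then show ?case by (simp add: power2_eq_square algebra_simps)
qed simp

text \<open>Vieta: this is the product of the two roots of the cubic, as a quadratic in its first
  variable.\<close>

lemma markov_seq_quadratic:
  "markov_seq x (Suc (Suc (Suc n))) * markov_seq x n
     = (markov_seq x (Suc (Suc n)))\<^sup>2 + (markov_seq x (Suc n))\<^sup>2 + (x - 3)"
  using markov_seq_cubic[of x n] by (simp add: power2_eq_square algebra_simps)

section \<open>Polynomiality\<close>

lemma eval_int_poly_pCons:
  "eval_int_poly (pCons a q) x = of_int a + x * eval_int_poly q x"
  by (simp add: eval_int_poly_def map_poly_pCons)

lemma eval_int_poly_0 [simp]: "eval_int_poly 0 x = 0"
  by (simp add: eval_int_poly_def)

lemma eval_int_poly_add: "eval_int_poly (p + q) x = eval_int_poly p x + eval_int_poly q x"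
  by (induction p q rule: poly_induct2) (simp_all add: eval_int_poly_pCons algebra_simps)

lemma eval_int_poly_smult: "eval_int_poly (smult a q) x = of_int a * eval_int_poly q x"
  by (induction q) (simp_all add: eval_int_poly_pCons algebra_simps)

lemma eval_int_poly_mult: "eval_int_poly (p * q) x = eval_int_poly p x * eval_int_poly q x"
  by (induction p)
    (simp_all add: eval_int_poly_pCons eval_int_poly_add eval_int_poly_smult algebra_simps)

lemma eval_int_poly_diff: "eval_int_poly (p - q) x = eval_int_poly p x - eval_int_poly q x"
  using eval_int_poly_add[of "p - q" q x] by simp

lemma eval_markov_seq: "eval_int_poly (markov_seq [:0, 1:] n) x = markov_seq x n"
  by (induction "[:0, 1:] :: int poly" n rule: markov_seq.induct)
    (simp_all add: eval_int_poly_diff eval_int_poly_mult eval_int_poly_pCons one_pCons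
      del: mult_pCons_left)

text \<open>This rule matches one step of the division-free recurrence: a product of two terms and one
  factor of degree 1. The subtraction is truncated, so it depends on both Fibonacci numbers on the
  right being positive.\<close>

lemma fib_minus_1_rec:
  "fib (Suc (Suc (Suc n))) - 1 = Suc ((fib (Suc (Suc n)) - 1) + (fib (Suc n) - 1))"
  using fib_neq_0_nat[OF zero_less_Suc, of n] fib_neq_0_nat[OF zero_less_Suc, of "Suc n"]
  by (subst fib.simps(3)) linarith

text \<open>The subtracted term has strictly smaller degree than the product term, so it disturbs neither
  the degree nor the leading coefficient. At index 0, where \<open>fib 0 = 0\<close>, the truncated
  \<open>fib 0 - 1 = 0\<close> is still the degree of 1.\<close>

lemma degree_markov_seq:
  "degree (markov_seq [:0, 1 :: 'a::idom:] n) = fib n - 1 \<and>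
   lead_coeff (markov_seq [:0, 1 :: 'a:] n) = 1"
proof (induction "[:0, 1:] :: 'a poly" n rule: markov_seq.induct)
  case (4 n)
  let ?M = "markov_seq [:0, 1 :: 'a:]"
  let ?P = "[:0, 1:] * ?M (Suc (Suc n)) * ?M (Suc n)"
  have "lead_coeff (?M (Suc (Suc n))) = 1" "lead_coeff (?M (Suc n)) = 1"
    using 4 by blast+
  then have lc: "lead_coeff ?P = 1"
    by (simp only: lead_coeff_mult) simp
  have "?M (Suc (Suc n)) \<noteq> 0" "?M (Suc n) \<noteq> 0"
    using 4 by auto
  then have deg: "degree ?P = fib (Suc (Suc (Suc n))) - 1"
    using 4 fib_minus_1_rec[of n] by (simp add: degree_mult_eq del: mult_pCons_left fib.simps)
  have "fib n - 1 < fib (Suc (Suc (Suc n))) - 1"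
    unfolding fib_minus_1_rec by simp
  then have less: "degree (?M n) < degree ?P"
    using 4 deg by simp
  have "degree (?P - ?M n) = degree ?P"
    using degree_add_eq_left[of "- ?M n" ?P] less by simp
  moreover have "coeff (?P - ?M n) (degree ?P) = 1"
    using lc less by (simp only: coeff_diff coeff_eq_0 diff_zero)
  ultimately show ?case
    using deg by (simp only: markov_seq.simps)
qed simp_all

section \<open>Growth in ordered domains\<close>

lemma markov_seq_ge_1_mono:
  fixes x :: "'a::linordered_idom"
  assumes "x > 2"
  shows "1 \<le> markov_seq x n \<and> markov_seq x n \<le> markov_seq x (Suc n) \<and>
    markov_seq x (Suc n) \<le> markov_seq x (Suc (Suc n)) \<and>
    markov_seq x (Suc (Suc n)) < markov_seq x (Suc (Suc (Suc n)))"
proof (induction n)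
  case 0
  show ?case using assms by simp
next
  case (Suc n)
  let ?u = "markov_seq x"
  let ?a = "?u (Suc n)" and ?b = "?u (Suc (Suc n))" and ?c = "?u (Suc (Suc (Suc n)))"
  have abc: "1 \<le> ?a" "?a \<le> ?b" "?b < ?c"
    using Suc by linarith+
  have "?c \<le> ?c * ?b"
    using abc mult_left_mono[of 1 ?b ?c] by (simp del: markov_seq.simps)
  then have "2 * ?c \<le> 2 * (?c * ?b)"
    by linarith
  also have "\<dots> < x * (?c * ?b)"
    using assms abc by (intro mult_strict_right_mono mult_pos_pos) linarith+
  finally have "?c < ?u (Suc (Suc (Suc (Suc n))))"
    using abc by (simp add: mult.assoc)
  then show ?case
    using abc by linarith
qed

lemma markov_seq_ge_1:
  fixes x :: "'a::linordered_idom"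
  shows "x > 2 \<Longrightarrow> 1 \<le> markov_seq x n"
  using markov_seq_ge_1_mono by blast

lemma markov_seq_strict_mono:
  fixes x :: "'a::linordered_idom"
  assumes "x > 2" "n \<ge> 2"
  shows "markov_seq x n < markov_seq x (Suc n)"
proof -
  obtain k where "n = Suc (Suc k)"
    using assms(2) by (metis add_2_eq_Suc le_Suc_ex)
  then show ?thesis
    using markov_seq_ge_1_mono[OF assms(1), of k] by simp
qed

lemma markov_seq_gt_1:
  fixes x :: "'a::linordered_idom"
  assumes "x > 2" "n \<ge> 3"
  shows "1 < markov_seq x n"
proof -
  obtain k where "n = Suc k" "k \<ge> 2"
    using assms(2) by (cases n) auto
  then show ?thesis
    using markov_seq_strict_mono[OF assms(1), of k] markov_seq_ge_1[OF assms(1), of k] by simp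
qed

lemma markov_seq_less_product:
  fixes x :: "'a::linordered_idom"
  assumes "x > 2"
  shows "markov_seq x (Suc (Suc (Suc n))) < x * markov_seq x (Suc (Suc n)) * markov_seq x (Suc n)"
  using markov_seq_ge_1[OF assms, of n] by simp

text \<open>One copy of the product absorbs the subtracted term. The step is strict only from index 4 on:
  the third term equals \<open>x - 1\<close>.\<close>

lemma markov_seq_ge_product:
  fixes x :: "'a::linordered_idom"
  assumes "x > 2"
  shows "(x - 1) * markov_seq x (Suc (Suc n)) * markov_seq x (Suc n)
      \<le> markov_seq x (Suc (Suc (Suc n)))"
    and "n > 0 \<Longrightarrow> (x - 1) * markov_seq x (Suc (Suc n)) * markov_seq x (Suc n)
      < markov_seq x (Suc (Suc (Suc n)))"
proof -
  let ?u = "markov_seq x"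
  have mono: "1 \<le> ?u n" "?u n \<le> ?u (Suc n)" "?u (Suc n) \<le> ?u (Suc (Suc n))"
    using markov_seq_ge_1_mono[OF assms, of n] by auto
  have prod: "?u (Suc (Suc n)) \<le> ?u (Suc (Suc n)) * ?u (Suc n)"
    using mono mult_left_mono[of 1 "?u (Suc n)" "?u (Suc (Suc n))"] by simp
  have split: "?u (Suc (Suc (Suc n))) = (x - 1) * ?u (Suc (Suc n)) * ?u (Suc n)
      + (?u (Suc (Suc n)) * ?u (Suc n) - ?u n)"
    by (simp add: algebra_simps)
  show "(x - 1) * ?u (Suc (Suc n)) * ?u (Suc n) \<le> ?u (Suc (Suc (Suc n)))"
    unfolding split using mono prod by linarith
  assume "n > 0"
  then have "?u (Suc n) < ?u (Suc (Suc n))"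
    using markov_seq_strict_mono[OF assms, of "Suc n"] by simp
  then show "(x - 1) * ?u (Suc (Suc n)) * ?u (Suc n) < ?u (Suc (Suc (Suc n)))"
    unfolding split using mono prod by linarith
qed

lemma markov_seq_upper_bound:
  fixes x :: "'a::linordered_idom"
  assumes "x > 2"
  shows "markov_seq x n \<le> x ^ (fib n - 1)" and "n \<ge> 3 \<Longrightarrow> markov_seq x n < x ^ (fib n - 1)"
proof -
  have "markov_seq x n \<le> x ^ (fib n - 1) \<and> (n \<ge> 3 \<longrightarrow> markov_seq x n < x ^ (fib n - 1))"
    using assms
  proof (induction x n rule: markov_seq.induct)
    case (4 x n)
    let ?u = "markov_seq x"
    have "?u (Suc (Suc n)) * ?u (Suc n) \<le> x ^ (fib (Suc (Suc n)) - 1) * x ^ (fib (Suc n) - 1)"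
      using 4 markov_seq_ge_1[OF \<open>x > 2\<close>, of "Suc n"] by (intro mult_mono) auto
    then have "x * ?u (Suc (Suc n)) * ?u (Suc n) \<le> x ^ (fib (Suc (Suc (Suc n))) - 1)"
      using \<open>x > 2\<close>
      by (simp only: fib_minus_1_rec power_Suc power_add mult.assoc) (simp add: mult_left_mono)
    then have "?u (Suc (Suc (Suc n))) < x ^ (fib (Suc (Suc (Suc n))) - 1)"
      using markov_seq_less_product[OF \<open>x > 2\<close>, of n] by linarith
    then show ?case by (simp only: order.strict_implies_order simp_thms)
  qed simp_all
  then show "markov_seq x n \<le> x ^ (fib n - 1)" and "n \<ge> 3 \<Longrightarrow> markov_seq x n < x ^ (fib n - 1)"
    by blast+
qed

lemma markov_seq_lower_bound:
  fixes x :: "'a::linordered_idom"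
  assumes "x > 2"
  shows "(x - 1) ^ (fib n - 1) \<le> markov_seq x n"
    and "n \<ge> 4 \<Longrightarrow> (x - 1) ^ (fib n - 1) < markov_seq x n"
proof -
  have "(x - 1) ^ (fib n - 1) \<le> markov_seq x n \<and>
      (n \<ge> 4 \<longrightarrow> (x - 1) ^ (fib n - 1) < markov_seq x n)"
    using assms
  proof (induction x n rule: markov_seq.induct)
    case (4 x n)
    let ?u = "markov_seq x"
    have "(x - 1) ^ (fib (Suc (Suc n)) - 1) * (x - 1) ^ (fib (Suc n) - 1)
        \<le> ?u (Suc (Suc n)) * ?u (Suc n)"
      using 4 markov_seq_ge_1[OF \<open>x > 2\<close>, of "Suc (Suc n)"] by (intro mult_mono) auto
    then have "(x - 1) ^ (fib (Suc (Suc (Suc n))) - 1) \<le> (x - 1) * ?u (Suc (Suc n)) * ?u (Suc n)"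
      using \<open>x > 2\<close>
      by (simp only: fib_minus_1_rec power_Suc power_add mult.assoc) (simp add: mult_left_mono)
    then have "(x - 1) ^ (fib (Suc (Suc (Suc n))) - 1) \<le> ?u (Suc (Suc (Suc n)))"
      and "n > 0 \<Longrightarrow> (x - 1) ^ (fib (Suc (Suc (Suc n))) - 1) < ?u (Suc (Suc (Suc n)))"
      using markov_seq_ge_product[OF \<open>x > 2\<close>, of n] by linarith+
    moreover have "n > 0" if "Suc (Suc (Suc n)) \<ge> 4"
      using that by simp
    ultimately show ?case by blast
  qed simp_all
  then show "(x - 1) ^ (fib n - 1) \<le> markov_seq x n"
    and "n \<ge> 4 \<Longrightarrow> (x - 1) ^ (fib n - 1) < markov_seq x n"
    by blast+
qed

section \<open>Uniqueness over the function field\<close>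

text \<open>The order on \<^typ>\<open>rat poly fract\<close> extends the order of \<^typ>\<open>rat poly\<close> in which a
  polynomial is positive when its leading coefficient is, so \<open>J\<close> exceeds every constant.\<close>

lemma N_gt_2: "N > 2"
proof -
  have "[:0, 1:] > (0 :: rat poly)"
    by (simp add: less_poly_def pos_poly_pCons)
  then have "J > 0"
    by (simp add: J_def zero_less_Fract_iff)
  then show ?thesis
    by (simp add: N_def)
qed

lemma tau_sequence_markov_seq: "tau_sequence (markov_seq N)"
  unfolding tau_sequence_def
proof (intro conjI allI)
  fix n
  show "markov_seq N (n + 3) * markov_seq N n
      = (markov_seq N (n + 2))\<^sup>2 + (markov_seq N (n + 1))\<^sup>2 + J"
    using markov_seq_quadratic[of N n] by (simp add: N_def numeral_3_eq_3 numeral_2_eq_2)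
qed (simp_all add: numeral_2_eq_2)

text \<open>The quadratic recurrence determines \<open>\<tau> (n + 3)\<close> once \<open>\<tau> n \<noteq> 0\<close>, and the terms of
  \<open>markov_seq N\<close> are at least 1 because \<open>N > 2\<close>.\<close>

lemma tau_sequence_unique:
  assumes "tau_sequence \<tau>"
  shows "\<tau> = markov_seq N"
proof
  fix n
  show "\<tau> n = markov_seq N n"
  proof (induction n rule: less_induct)
    case (less n)
    show ?case
    proof (cases "n < 3")
      case True
      then have "n = 0 \<or> n = 1 \<or> n = 2" by auto
      then show ?thesis
        using assms tau_sequence_markov_seq unfolding tau_sequence_def by metis
    next
      case False
      then obtain k where n: "n = k + 3"
        by (metis add.commute le_Suc_ex not_less)
      have "\<tau> (k + 3) * \<tau> k = (\<tau> (k + 2))\<^sup>2 + (\<tau> (k + 1))\<^sup>2 + J"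
        using assms by (simp add: tau_sequence_def)
      also have "\<dots> = (markov_seq N (k + 2))\<^sup>2 + (markov_seq N (k + 1))\<^sup>2 + J"
        using less n by simp
      also have "\<dots> = markov_seq N (k + 3) * markov_seq N k"
        using tau_sequence_markov_seq by (simp only: tau_sequence_def)
      finally have "\<tau> n * markov_seq N k = markov_seq N n * markov_seq N k"
        using less n by simp
      moreover have "markov_seq N k \<noteq> 0"
        using markov_seq_ge_1[OF N_gt_2, of k] by auto
      ultimately show ?thesis by simp
    qed
  qed
qed

text \<open>The polynomials \<open>p n\<close> are the same division-free sequence, run at the variable of
  \<open>int poly\<close>; evaluation, being a ring homomorphism, carries them to the sequence at \<open>N\<close> and
  at real \<open>x\<close>.\<close>

theorem proposition2:
  shows "(\<exists>!\<tau>. tau_sequence \<tau>) \<and>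
    (\<forall>\<tau>. tau_sequence \<tau> \<longrightarrow>
      (\<exists>p :: nat \<Rightarrow> int poly.
        (\<forall>n. \<tau> n = eval_int_poly (p n) N \<and> lead_coeff (p n) = 1) \<and>
        (\<forall>n>0. degree (p n) = fib n - 1) \<and>
        (\<forall>x::real. x > 2 \<longrightarrow>
          (\<forall>n\<ge>3. eval_int_poly (p (n + 1)) x > eval_int_poly (p n) x \<and>
                 eval_int_poly (p n) x > 1) \<and>
          (\<forall>n\<ge>4. (x - 1) ^ (fib n - 1) < eval_int_poly (p n) x \<and>
                 eval_int_poly (p n) x < x ^ (fib n - 1)))))"
proof (intro conjI allI impI)
  show "\<exists>!\<tau>. tau_sequence \<tau>"
    using tau_sequence_markov_seq tau_sequence_unique by blast
next
  fix \<tau>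
  assume "tau_sequence \<tau>"
  then have \<tau>: "\<tau> = markov_seq N"
    by (rule tau_sequence_unique)
  show "\<exists>p :: nat \<Rightarrow> int poly.
        (\<forall>n. \<tau> n = eval_int_poly (p n) N \<and> lead_coeff (p n) = 1) \<and>
        (\<forall>n>0. degree (p n) = fib n - 1) \<and>
        (\<forall>x::real. x > 2 \<longrightarrow>
          (\<forall>n\<ge>3. eval_int_poly (p (n + 1)) x > eval_int_poly (p n) x \<and>
                 eval_int_poly (p n) x > 1) \<and>
          (\<forall>n\<ge>4. (x - 1) ^ (fib n - 1) < eval_int_poly (p n) x \<and>
                 eval_int_poly (p n) x < x ^ (fib n - 1)))"
  proof (intro exI conjI allI impI)
    let ?p = "markov_seq [:0, 1 :: int:]"
    fix n :: nat and x :: real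
    show "\<tau> n = eval_int_poly (?p n) N"
      by (simp only: \<tau> eval_markov_seq)
    show "lead_coeff (?p n) = 1" and "degree (?p n) = fib n - 1"
      using degree_markov_seq by blast+
    assume x: "x > 2"
    show "eval_int_poly (?p (n + 1)) x > eval_int_poly (?p n) x" if "n \<ge> 3"
      using markov_seq_strict_mono[OF x, of n] that by (simp add: eval_markov_seq)
    show "eval_int_poly (?p n) x > 1" if "n \<ge> 3"
      using markov_seq_gt_1[OF x that] by (simp only: eval_markov_seq)
    show "(x - 1) ^ (fib n - 1) < eval_int_poly (?p n) x" if "n \<ge> 4"
      using markov_seq_lower_bound(2)[OF x that] by (simp only: eval_markov_seq)
    show "eval_int_poly (?p n) x < x ^ (fib n - 1)" if "n \<ge> 4"
      using markov_seq_upper_bound(2)[OF x, of n] that by (simp only: eval_markov_seq)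
  qed
qed

end
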